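(* Let $P_1 = \{001,111,120,222,212\}$, $Q_1 = P_1 \cup \{000\}$, $P_2 = \{011,111,120,222,202\}$, $Q_2 = P_2 \cup \{000\}$ (subsets of $\{0,1,2\}^3$), and $P_3 = \{0101,1111,1220,2222,2012\}$, $Q_3 = P_3 \cup \{0000\}$ (subsets of $\{0,1,2\}^4$). Then $\operatorname{NRD}(P_1 \mid Q_1, n) \ge \Omega(n^{4/3})$, $\operatorname{NRD}(P_2 \mid Q_2, n) \ge \Omega(n^{4/3})$, and $\operatorname{NRD}(P_3 \mid Q_3, n) \ge \Omega(n^{6/5})$.
   Context: These are projections of $\operatorname{Cat}_5 = \{01012,11111,12201,22222,20120\}$ and $\operatorname{Cat}_5^{+} = \operatorname{Cat}_5 \cup\{00000\}$ onto coordinates $\{1,3,4\}$, $\{1,2,4\}$, $\{1,2,3,4\}$ respectively. An instance is a hypergraph $H=(V,E)$ with $E \subseteq V^r$ (ordered tuples). For $P \subsetneq Q \subseteq D^r$, $H$ is a non-redundant instance of $\operatorname{CSP}(P\mid Q)$ if for every $e\in E$ there is $\psi_e : V\to D$ with $\psi_e(e')\in P$ for all $e'\neq e$ and $\psi_e(e)\in Q\setminus P$ (coordinatewise application); $\operatorname{NRD}(P\mid Q,n)$ is the maximum number of edges of such an instance on $n$ vertices. *)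

theory Defs
  imports Complex_Main "HOL-Library.FuncSet" "HOL-Library.Landau_Symbols"
begin

text \<open>
  Tuples are lists, so coordinatewise application of a map is \<open>map\<close>. Repeated vertices inside
  an edge are allowed.
\<close>

abbreviation tuples :: "nat \<Rightarrow> 'a set \<Rightarrow> 'a list set" where
  "tuples r A \<equiv> {xs. set xs \<subseteq> A \<and> length xs = r}"

definition nonredundant_instance ::
    "'d set \<Rightarrow> nat \<Rightarrow> 'd list set \<Rightarrow> 'd list set \<Rightarrow> 'v set \<Rightarrow> 'v list set \<Rightarrow> bool" where
  "nonredundant_instance D r P Q V E \<longleftrightarrow>
     E \<subseteq> tuples r V \<and>
     (\<forall>e\<in>E. \<exists>\<psi> \<in> V \<rightarrow> D. (\<forall>e'\<in>E - {e}. map \<psi> e' \<in> P) \<and> map \<psi> e \<in> Q - P)"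

text \<open>
  Vertex sets are taken inside \<open>nat\<close>. This is no restriction (\<open>card_le_NRD\<close> below), and the
  maximum is over a finite nonempty set (\<open>NRD_maximum\<close>).
\<close>

definition NRD :: "'d set \<Rightarrow> nat \<Rightarrow> 'd list set \<Rightarrow> 'd list set \<Rightarrow> nat \<Rightarrow> nat" where
  "NRD D r P Q n =
     Max {card E | (V :: nat set) E. finite V \<and> card V = n \<and> nonredundant_instance D r P Q V E}"

abbreviation D3 :: "nat set" where "D3 \<equiv> {0, 1, 2}"

definition P1 :: "nat list set" where
  "P1 = {[0,0,1], [1,1,1], [1,2,0], [2,2,2], [2,1,2]}"

definition Q1 :: "nat list set" where
  "Q1 = P1 \<union> {[0,0,0]}"

definition P2 :: "nat list set" where
  "P2 = {[0,1,1], [1,1,1], [1,2,0], [2,2,2], [2,0,2]}"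

definition Q2 :: "nat list set" where
  "Q2 = P2 \<union> {[0,0,0]}"

definition P3 :: "nat list set" where
  "P3 = {[0,1,0,1], [1,1,1,1], [1,2,2,0], [2,2,2,2], [2,0,1,2]}"

definition Q3 :: "nat list set" where
  "Q3 = P3 \<union> {[0,0,0,0]}"

lemma P_psubset_Q:
  "P1 \<subset> Q1" "Q1 \<subseteq> tuples 3 D3"
  "P2 \<subset> Q2" "Q2 \<subseteq> tuples 3 D3"
  "P3 \<subset> Q3" "Q3 \<subseteq> tuples 4 D3"
proof -
  have "[0,0,0] \<notin> P1" "[0,0,0] \<notin> P2" "[0,0,0,0] \<notin> P3"
    by (simp_all add: P1_def P2_def P3_def)
  then show "P1 \<subset> Q1" "P2 \<subset> Q2" "P3 \<subset> Q3"
    unfolding Q1_def Q2_def Q3_def by blast+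
  show "Q1 \<subseteq> tuples 3 D3" "Q2 \<subseteq> tuples 3 D3" "Q3 \<subseteq> tuples 4 D3"
    unfolding P1_def Q1_def P2_def Q2_def P3_def Q3_def Un_subset_iff insert_subset
    by simp_all
qed

lemma card_nonredundant_instance_le:
  assumes "finite V" "nonredundant_instance D r P Q V E"
  shows "card E \<le> card V ^ r"
proof -
  have "E \<subseteq> tuples r V"
    using assms(2) by (simp add: nonredundant_instance_def)
  then have "card E \<le> card (tuples r V)"
    by (intro card_mono finite_lists_length_eq assms(1))
  then show ?thesis
    by (simp add: card_lists_length_eq assms(1))
qed

lemma NRD_maximum:
  "finite {card E | (V :: nat set) E.
     finite V \<and> card V = n \<and> nonredundant_instance D r P Q V E}" (is "finite ?S")
  "{card E | (V :: nat set) E.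
     finite V \<and> card V = n \<and> nonredundant_instance D r P Q V E} \<noteq> {}"
proof -
  have "?S \<subseteq> {..n ^ r}"
    by (auto dest: card_nonredundant_instance_le)
  then show "finite ?S"
    by (rule finite_subset) simp
  have "nonredundant_instance D r P Q {..<n} {}"
    by (simp add: nonredundant_instance_def)
  then have "card ({} :: nat list set) \<in> ?S"
    using finite_lessThan card_lessThan by blast
  then show "?S \<noteq> {}" by blast
qed

lemma card_le_NRD:
  fixes V :: "'v set"
  assumes V: "finite V" and E: "nonredundant_instance D r P Q V E"
  shows "card E \<le> NRD D r P Q (card V)"
proof -
  obtain f :: "'v \<Rightarrow> nat" where f: "bij_betw f V {..<card V}"
    using ex_bij_betw_finite_nat[OF V] by (auto simp: atLeast0LessThan)
  define g where "g = the_inv_into V f"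
  have gf: "g (f v) = v" if "v \<in> V" for v
    using f that by (simp add: g_def bij_betw_def the_inv_into_f_f)
  have gV: "g i \<in> V" if "i < card V" for i
    using bij_betw_the_inv_into[OF f] that by (auto simp: g_def bij_betw_def)
  have ET: "set e \<subseteq> V" "length e = r" if "e \<in> E" for e
    using E that unfolding nonredundant_instance_def by blast+
  have inv: "map g (map f e) = e" if "e \<in> E" for e
    using ET[OF that] gf by (auto intro!: map_idI)
  have inj: "inj_on (map f) E"
    using inv by (rule inj_on_inverseI)
  have "nonredundant_instance D r P Q {..<card V} (map f ` E)"
    unfolding nonredundant_instance_def
  proof (intro conjI ballI)
    show "map f ` E \<subseteq> tuples r {..<card V}"
    proof
      fix e assume "e \<in> map f ` E"
      then obtain e0 where e0: "e0 \<in> E" "e = map f e0" by blast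
      have "f ` set e0 \<subseteq> f ` V" using ET(1)[OF e0(1)] by (rule image_mono)
      then show "e \<in> tuples r {..<card V}"
        using ET(2)[OF e0(1)] f e0(2) by (simp add: bij_betw_def)
    qed
  next
    fix e assume "e \<in> map f ` E"
    then obtain e0 where e0: "e0 \<in> E" "e = map f e0" by blast
    obtain \<psi> where \<psi>: "\<psi> \<in> V \<rightarrow> D" "\<forall>e'\<in>E - {e0}. map \<psi> e' \<in> P" "map \<psi> e0 \<in> Q - P"
      using E e0(1) by (auto simp: nonredundant_instance_def)
    have eq: "map (\<psi> \<circ> g) (map f e') = map \<psi> e'" if "e' \<in> E" for e'
      using inv[OF that] by (metis map_map)
    show "\<exists>\<psi> \<in> {..<card V} \<rightarrow> D.
        (\<forall>e'\<in>map f ` E - {e}. map \<psi> e' \<in> P) \<and> map \<psi> e \<in> Q - P"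
    proof (intro bexI[of _ "\<psi> \<circ> g"] conjI ballI)
      show "\<psi> \<circ> g \<in> {..<card V} \<rightarrow> D" using \<psi>(1) gV by auto
      show "map (\<psi> \<circ> g) e \<in> Q - P" unfolding e0(2) eq[OF e0(1)] by (rule \<psi>(3))
      fix e' assume "e' \<in> map f ` E - {e}"
      then obtain e1 where e1: "e1 \<in> E" "e1 \<in> E - {e0}" "e' = map f e1" using e0 by blast
      show "map (\<psi> \<circ> g) e' \<in> P" unfolding e1(3) eq[OF e1(1)] using \<psi>(2) e1(2) by (rule bspec)
    qed
  qed
  then have "card (map f ` E) \<in> {card E | (W :: nat set) E.
      finite W \<and> card W = card V \<and> nonredundant_instance D r P Q W E}"
    using finite_lessThan card_lessThan by blast
  then have "card (map f ` E) \<le> NRD D r P Q (card V)"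
    unfolding NRD_def by (rule Max_ge[OF NRD_maximum(1)])
  then show ?thesis using card_image[OF inj] by simp
qed

end

(*
  In the affine plane over a field of q elements two distinct lines share at most one point, and
  the q^2 non-vertical lines carry q^3 flags (l, p), that is, points p on lines l.

  P1, P2: the edges are the pairs of a flag (l, p) and a level t, a structure with q^4 elements.
  The three vertices of an edge are its three 'projections' (l, p), (l, t), (p, t), so there are
  3 q^3 vertices. The same hypergraph serves both predicates, with the coordinates reversed.

  P3: the edges are the pairs of flags ((l, p), (m, r)), q^6 in number. Each of the four vertices
  of an edge forgets one of l, p, m, r, so there are 4 q^5 vertices.

  For a distinguished edge e the colour of a vertex depends only on how it meets the points, lines
  and levels of e, and 'two lines share at most one point' is what makes the colouring consistent.
  Taking q = 2^k gives vertex counts of bounded ratio, and NRD is monotone in n.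
*)
theory Submission
  imports Defs "HOL-Algebra.Algebraic_Closure_Type" "HOL-Library.Z2"
begin

section \<open>Padding and indexed families of edges\<close>

text \<open>Added vertices lie in no edge, so every colouring extends to them by the constant
  0.\<close>

lemma NRD_mono:
  assumes "0 \<in> D" "m \<le> n"
  shows "NRD D r P Q m \<le> NRD D r P Q n"
proof -
  have "NRD D r P Q m \<in> {card E | (V :: nat set) E.
      finite V \<and> card V = m \<and> nonredundant_instance D r P Q V E}"
    unfolding NRD_def by (rule Max_in[OF NRD_maximum])
  then obtain V :: "nat set" and E
    where V: "finite V" "card V = m" and E: "nonredundant_instance D r P Q V E"
      and eq: "NRD D r P Q m = card E" by blast
  obtain W where W: "finite W" "card W = n" "V \<subseteq> W"
    using infinite_arbitrarily_large[of "UNIV - V" "n - m"] V assms(2)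
    by (metis Diff_disjoint Diff_infinite_finite card_Un_disjoint disjoint_iff finite_Un
        infinite_UNIV_nat le_add_diff_inverse subset_iff sup_ge1)
  have "nonredundant_instance D r P Q W E"
    unfolding nonredundant_instance_def
  proof (intro conjI ballI)
    show "E \<subseteq> tuples r W" using E W(3) unfolding nonredundant_instance_def by blast
    fix e assume e: "e \<in> E"
    obtain \<psi> where \<psi>: "\<psi> \<in> V \<rightarrow> D" "\<forall>e'\<in>E - {e}. map \<psi> e' \<in> P" "map \<psi> e \<in> Q - P"
      using E e by (auto simp: nonredundant_instance_def)
    have eq: "map (\<lambda>v. if v \<in> V then \<psi> v else 0) e' = map \<psi> e'" if "e' \<in> E" for e'
      using E that by (auto simp: nonredundant_instance_def)
    show "\<exists>\<psi>\<in>W \<rightarrow> D. (\<forall>e'\<in>E - {e}. map \<psi> e' \<in> P) \<and> map \<psi> e \<in> Q - P"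
      using \<psi> e assms(1) by (intro bexI[of _ "\<lambda>v. if v \<in> V then \<psi> v else 0"]) (auto simp: eq)
  qed
  then show ?thesis using card_le_NRD[OF W(1)] W(2) eq by metis
qed

lemma nonredundant_instance_imageI:
  assumes "\<And>i. i \<in> I \<Longrightarrow> f i \<in> tuples r V"
    and "\<And>i v. i \<in> I \<Longrightarrow> \<psi> i v \<in> D"
    and "\<And>i. i \<in> I \<Longrightarrow> map (\<psi> i) (f i) \<in> Q - P"
    and "\<And>i j. i \<in> I \<Longrightarrow> j \<in> I \<Longrightarrow> j \<noteq> i \<Longrightarrow> map (\<psi> i) (f j) \<in> P"
  shows "nonredundant_instance D r P Q V (f ` I)"
  unfolding nonredundant_instance_def
proof (intro conjI ballI)
  show "f ` I \<subseteq> tuples r V" using assms(1) by blast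
  fix e assume "e \<in> f ` I"
  then obtain i where "i \<in> I" "e = f i" by blast
  then show "\<exists>\<psi>\<in>V \<rightarrow> D. (\<forall>e'\<in>f ` I - {e}. map \<psi> e' \<in> P) \<and> map \<psi> e \<in> Q - P"
    using assms(2-4) by (intro bexI[of _ "\<psi> i"]) blast+
qed

section \<open>Incidence structures\<close>

text \<open>\<open>meet\<close> says that the incidence graph has no 4-cycle, a form symmetric in
  points and lines.\<close>

locale partial_linear_space =
  fixes L :: "'l set" and P :: "'p set" and Fl :: "('l \<times> 'p) set"
  assumes finite_LP: "finite L" "finite P"
    and flags: "Fl \<subseteq> L \<times> P"
    and meet: "\<lbrakk>(l, p) \<in> Fl; (l, p') \<in> Fl; (l', p) \<in> Fl; (l', p') \<in> Fl\<rbrakk> \<Longrightarrow> l = l' \<or> p = p'"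
begin

lemma finite_Fl: "finite Fl"
  using finite_LP flags finite_subset by blast

end

section \<open>Flags with levels, for \<open>P1\<close> and \<open>P2\<close>\<close>

datatype ('l, 'p, 't) vertex3 = LP 'l 'p | LT 'l 't | PT 'p 't

fun edge1 :: "('l \<times> 'p) \<times> 't \<Rightarrow> ('l, 'p, 't) vertex3 list" where
  "edge1 ((l, p), t) = [LP l p, LT l t, PT p t]"

fun edge2 :: "('l \<times> 'p) \<times> 't \<Rightarrow> ('l, 'p, 't) vertex3 list" where
  "edge2 ((l, p), t) = [PT p t, LT l t, LP l p]"

context partial_linear_space
begin

text \<open>\<open>LT l t\<close> does not see the point \<open>p\<close> of its edge, so
  \<open>(l, p0) \<in> Fl\<close> stands in for \<open>p = p0\<close>. By \<open>meet\<close> the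
  two agree when \<open>l \<noteq> l0\<close> and \<open>p\<close> is on \<open>l0\<close>.\<close>

fun colour1 :: "('l \<times> 'p) \<times> 't \<Rightarrow> ('l, 'p, 't) vertex3 \<Rightarrow> nat" where
  "colour1 ((l0, p0), t0) (LP l p) = (if l = l0 then 0 else if (l0, p) \<in> Fl then 1 else 2)"
| "colour1 ((l0, p0), t0) (LT l t) = (if l = l0 then 0 else if (l, p0) \<in> Fl \<and> t = t0 then 2 else 1)"
| "colour1 ((l0, p0), t0) (PT p t) = (if (l0, p) \<in> Fl then if p = p0 \<and> t = t0 then 0 else 1 else 2)"

fun colour2 :: "('l \<times> 'p) \<times> 't \<Rightarrow> ('l, 'p, 't) vertex3 \<Rightarrow> nat" where
  "colour2 ((l0, p0), t0) (LP l p) =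
     (if (l0, p) \<in> Fl \<and> p \<noteq> p0 then 2 else if (l, p0) \<in> Fl \<and> l \<noteq> l0 then 1 else 0)"
| "colour2 ((l0, p0), t0) (LT l t) =
     (if l = l0 \<and> t = t0 then 0 else if (l, p0) \<in> Fl \<and> l \<noteq> l0 then 1 else 2)"
| "colour2 ((l0, p0), t0) (PT p t) =
     (if p = p0 \<and> t = t0 then 0 else if (l0, p) \<in> Fl \<and> p \<noteq> p0 then 2 else 1)"

definition V3 :: "'t set \<Rightarrow> ('l, 'p, 't) vertex3 set" where
  "V3 T = case_prod LP ` Fl \<union> case_prod LT ` (L \<times> T) \<union> case_prod PT ` (P \<times> T)"

lemma mem_V3:
  "(l, p) \<in> Fl \<Longrightarrow> LP l p \<in> V3 T"
  "l \<in> L \<Longrightarrow> t \<in> T \<Longrightarrow> LT l t \<in> V3 T"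
  "p \<in> P \<Longrightarrow> t \<in> T \<Longrightarrow> PT p t \<in> V3 T"
  by (simp_all add: V3_def image_iff split: prod.splits) blast+

lemma finite_V3: "finite T \<Longrightarrow> finite (V3 T)"
  by (simp add: V3_def finite_LP finite_Fl)

lemma card_V3: "finite T \<Longrightarrow> card (V3 T) \<le> card Fl + card L * card T + card P * card T"
  unfolding V3_def
  by (intro order.trans[OF card_Un_le] add_mono order.trans[OF card_image_le])
    (simp_all add: finite_LP finite_Fl)

text \<open>Edges on \<open>l0\<close> other than \<open>i\<close> get 001, edges on another line
  with a point on \<open>l0\<close> get 111 or 120, and a point off \<open>l0\<close> gives 222 or
  212.\<close>

lemma nonredundant_edges1: "nonredundant_instance D3 3 P1 Q1 (V3 T) (edge1 ` (Fl \<times> T))"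
proof (rule nonredundant_instance_imageI[where \<psi> = colour1])
  fix i assume i: "i \<in> Fl \<times> T"
  then obtain l0 p0 t0 where [simp]: "i = ((l0, p0), t0)" by (metis surj_pair)
  have I: "(l0, p0) \<in> Fl" "t0 \<in> T" "l0 \<in> L" "p0 \<in> P" using i flags by auto
  then show "edge1 i \<in> tuples 3 (V3 T)"
    by (simp add: mem_V3)
  show "colour1 i v \<in> D3" for v by (cases v) auto
  show "map (colour1 i) (edge1 i) \<in> Q1 - P1" using I by (simp add: Q1_def P1_def)
  fix j assume j: "j \<in> Fl \<times> T" "j \<noteq> i"
  then obtain l p t where [simp]: "j = ((l, p), t)" by (metis surj_pair)
  \<comment> \<open>This rules out 121, the pattern at level \<open>t0\<close> of a second line
    through \<open>p0\<close> and another point of \<open>l0\<close>.\<close>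
  have "l = l0 \<or> p = p0" if "(l0, p) \<in> Fl" "(l, p0) \<in> Fl"
    using that j I meet[of l0 p0 p l] by auto
  then show "map (colour1 i) (edge1 j) \<in> P1"
    using j I
    by (cases "(l0, p) \<in> Fl"; cases "(l, p0) \<in> Fl"; cases "l = l0"; cases "p = p0"; cases "t = t0")
      (simp_all add: P1_def)
qed

text \<open>A point \<open>p \<noteq> p0\<close> on \<open>l0\<close> gives 202 or 222, and a line
  \<open>l \<noteq> l0\<close> through \<open>p0\<close> gives 011 or 111; \<open>meet\<close> makes
  these classes disjoint. All other edges get 120, except \<open>i\<close> with 000.\<close>

lemma nonredundant_edges2: "nonredundant_instance D3 3 P2 Q2 (V3 T) (edge2 ` (Fl \<times> T))"
proof (rule nonredundant_instance_imageI[where \<psi> = colour2])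
  fix i assume i: "i \<in> Fl \<times> T"
  then obtain l0 p0 t0 where [simp]: "i = ((l0, p0), t0)" by (metis surj_pair)
  have I: "(l0, p0) \<in> Fl" "t0 \<in> T" "l0 \<in> L" "p0 \<in> P" using i flags by auto
  then show "edge2 i \<in> tuples 3 (V3 T)"
    by (simp add: mem_V3)
  show "colour2 i v \<in> D3" for v by (cases v) auto
  show "map (colour2 i) (edge2 i) \<in> Q2 - P2" using I by (simp add: Q2_def P2_def)
  fix j assume j: "j \<in> Fl \<times> T" "j \<noteq> i"
  then obtain l p t where [simp]: "j = ((l, p), t)" by (metis surj_pair)
  have "l = l0 \<or> p = p0" if "(l0, p) \<in> Fl" "(l, p0) \<in> Fl"
    using that j I meet[of l0 p0 p l] by auto
  then show "map (colour2 i) (edge2 j) \<in> P2"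
    using j I
    by (cases "(l0, p) \<in> Fl"; cases "(l, p0) \<in> Fl"; cases "l = l0"; cases "p = p0"; cases "t = t0")
      (simp_all add: P2_def)
qed

end

section \<open>Pairs of flags, for \<open>P3\<close>\<close>

datatype ('l, 'p) vertex4 = VA 'l 'l 'p | VB 'p 'l 'p | VC 'l 'p 'l | VD 'l 'p 'p

fun edge3 :: "('l \<times> 'p) \<times> ('l \<times> 'p) \<Rightarrow> ('l, 'p) vertex4 list" where
  "edge3 ((l, p), (m, r)) = [VA l m r, VB p m r, VC l p m, VD l p r]"

context partial_linear_space
begin

text \<open>Swapping the two flags exchanges \<open>VA\<close> with \<open>VC\<close> and
  \<open>VB\<close> with \<open>VD\<close>, and preserves \<open>P3\<close>. \<open>VA\<close> and
  \<open>VC\<close>, lacking \<open>p\<close> and \<open>r\<close>, test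
  \<open>(l, p0) \<in> Fl\<close> and \<open>(m, r0) \<in> Fl\<close> instead of
  \<open>p = p0\<close> and \<open>r = r0\<close>.\<close>

fun colour3 :: "('l \<times> 'p) \<times> ('l \<times> 'p) \<Rightarrow> ('l, 'p) vertex4 \<Rightarrow> nat" where
  "colour3 ((l0, p0), (m0, r0)) (VA l m r) =
     (if l = l0 \<and> m = m0 then 0
      else if (m0, r) \<notin> Fl then 2
      else if l = l0 then 1
      else if (l, p0) \<in> Fl \<and> r = r0 then 2 else 1)"
| "colour3 ((l0, p0), (m0, r0)) (VB p m r) =
     (if (l0, p) \<notin> Fl then 2
      else if (m0, r) \<notin> Fl then if p = p0 \<and> (m, r0) \<in> Fl then 2 else 0
      else if p = p0 \<and> r = r0 then if m = m0 then 0 else 2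
      else 1)"
| "colour3 ((l0, p0), (m0, r0)) (VC l p m) =
     (if l = l0 \<and> m = m0 then 0
      else if (l0, p) \<notin> Fl then 2
      else if m = m0 then 1
      else if p = p0 \<and> (m, r0) \<in> Fl then 2 else 1)"
| "colour3 ((l0, p0), (m0, r0)) (VD l p r) =
     (if (m0, r) \<notin> Fl then 2
      else if (l0, p) \<notin> Fl then if (l, p0) \<in> Fl \<and> r = r0 then 2 else 0
      else if p = p0 \<and> r = r0 then if l = l0 then 0 else 2
      else 1)"

definition V4 :: "('l, 'p) vertex4 set" where
  "V4 = (\<lambda>(l, m, r). VA l m r) ` (L \<times> Fl) \<union> (\<lambda>(p, m, r). VB p m r) ` (P \<times> Fl) \<union>
        (\<lambda>((l, p), m). VC l p m) ` (Fl \<times> L) \<union> (\<lambda>((l, p), r). VD l p r) ` (Fl \<times> P)"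

lemma mem_V4:
  "l \<in> L \<Longrightarrow> (m, r) \<in> Fl \<Longrightarrow> VA l m r \<in> V4"
  "p \<in> P \<Longrightarrow> (m, r) \<in> Fl \<Longrightarrow> VB p m r \<in> V4"
  "(l, p) \<in> Fl \<Longrightarrow> m \<in> L \<Longrightarrow> VC l p m \<in> V4"
  "(l, p) \<in> Fl \<Longrightarrow> r \<in> P \<Longrightarrow> VD l p r \<in> V4"
  by (simp_all add: V4_def image_iff split: prod.splits) blast+

lemma finite_V4: "finite V4"
  by (simp add: V4_def finite_LP finite_Fl)

lemma card_V4: "card V4 \<le> card L * card Fl + card P * card Fl + card Fl * card L + card Fl * card P"
  unfolding V4_def
  by (intro order.trans[OF card_Un_le] add_mono order.trans[OF card_image_le])
    (simp_all add: finite_LP finite_Fl)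

text \<open>Apart from \<open>i\<close>: if \<open>p\<close> is on \<open>l0\<close> and
  \<open>r\<close> on \<open>m0\<close>, the pattern is 0101 for \<open>l = l0\<close>,
  \<open>m = m0\<close>, and otherwise 1111 unless \<open>p = p0\<close>, \<open>r = r0\<close>,
  when it is 1220, 2012 or 2222. With only \<open>p\<close> on its line it is 2012 or 2222, with
  only \<open>r\<close> 1220 or 2222, with neither 2222.\<close>

lemma nonredundant_edges3: "nonredundant_instance D3 4 P3 Q3 V4 (edge3 ` (Fl \<times> Fl))"
proof (rule nonredundant_instance_imageI[where \<psi> = colour3])
  fix i assume i: "i \<in> Fl \<times> Fl"
  then obtain l0 p0 m0 r0 where [simp]: "i = ((l0, p0), (m0, r0))" by (metis surj_pair)
  have I: "(l0, p0) \<in> Fl" "(m0, r0) \<in> Fl" "l0 \<in> L" "p0 \<in> P" "m0 \<in> L" "r0 \<in> P" using i flags by auto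
  then show "edge3 i \<in> tuples 4 V4"
    by (simp add: mem_V4)
  show "colour3 i v \<in> D3" for v by (cases v) auto
  show "map (colour3 i) (edge3 i) \<in> Q3 - P3" using I by (simp add: Q3_def P3_def)
  fix j assume j: "j \<in> Fl \<times> Fl" "j \<noteq> i"
  then obtain l p m r where [simp]: "j = ((l, p), (m, r))" by (metis surj_pair)
  have "l = l0 \<or> p = p0" if "(l0, p) \<in> Fl" "(l, p0) \<in> Fl"
    using that j I meet[of l0 p0 p l] by auto
  moreover have "m = m0 \<or> r = r0" if "(m0, r) \<in> Fl" "(m, r0) \<in> Fl"
    using that j I meet[of m0 r0 r m] by auto
  ultimately show "map (colour3 i) (edge3 j) \<in> P3"
    using j I
    by (cases "(l0, p) \<in> Fl"; cases "(l, p0) \<in> Fl"; cases "l = l0"; cases "p = p0";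
        cases "(m0, r) \<in> Fl"; cases "(m, r0) \<in> Fl"; cases "m = m0"; cases "r = r0")
      (simp_all add: P3_def)
qed

end

section \<open>Finite fields of characteristic two\<close>

lemma CHAR_bit: "CHAR(bit) = 2"
proof (rule CHAR_eqI)
  show "of_nat 2 = (0 :: bit)" by simp
  fix n assume "of_nat n = (0 :: bit)"
  then show "2 dvd n" by (cases "even n") (auto elim!: oddE)
qed

text \<open>At a repeated root \<open>x\<close> the factor \<open>[:-x, 1:]\<close> occurs squared
  and the derivative vanishes too; hence the multiset of roots is a set.\<close>

lemma card_roots_separable:
  fixes p :: "'a :: alg_closed_field poly"
  assumes "p \<noteq> 0" and sep: "\<And>x. poly p x = 0 \<Longrightarrow> poly (pderiv p) x \<noteq> 0"
  shows "card {x. poly p x = 0} = degree p"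
proof -
  obtain A where A: "size A = degree p" "p = smult (lead_coeff p) (\<Prod>x\<in>#A. [:-x, 1:])"
    using alg_closed_imp_factorization[OF assms(1)] by blast
  have roots: "{x. poly p x = 0} = set_mset A"
    by (subst A(2)) (use assms(1) in \<open>auto simp: poly_prod_mset prod_mset_zero_iff\<close>)
  have "count A x = 1" if "x \<in># A" for x
  proof (rule ccontr)
    assume ne: "count A x \<noteq> 1"
    from multi_member_split[OF that] obtain A' where A': "A = add_mset x A'" by blast
    then have mem: "x \<in># A'" using ne by (simp flip: count_greater_zero_iff)
    from multi_member_split[OF mem] obtain B where "A' = add_mset x B" by blast
    then have B: "A = add_mset x (add_mset x B)" using A' by simp
    define q where "q = smult (lead_coeff p) (\<Prod>x\<in>#B. [:-x, 1:])"
    have "smult c (\<Prod>x\<in>#A. [:-x, 1:]) = [:-x, 1:] * ([:-x, 1:] * smult c (\<Prod>x\<in>#B. [:-x, 1:]))" for c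
      unfolding B image_mset_add_mset prod_mset.add_mset mult_smult_right by (rule refl)
    then have p: "p = [:-x, 1:] * ([:-x, 1:] * q)"
      unfolding q_def using A(2) by metis
    have "poly p x = 0" "poly (pderiv p) x = 0"
      unfolding p by (simp_all add: pderiv_mult del: mult_pCons_left)
    then show False using sep by blast
  qed
  then have "size A = card (set_mset A)"
    unfolding size_multiset_overloaded_eq by simp
  then show ?thesis using A(1) roots by simp
qed

lemma ex_finite_subsemiring_card_power2:
  "\<exists>F :: bit alg_closure set. finite F \<and> card F = 2 ^ k \<and>
     (\<forall>x\<in>F. \<forall>y\<in>F. x + y \<in> F \<and> x * y \<in> F)"
proof (cases "k = 0")
  case True
  \<comment> \<open>For \<open>k = 0\<close> the polynomial used below is zero, so
    \<open>{0}\<close> is given directly.\<close>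
  then show ?thesis by (intro exI[of _ "{0}"]) auto
next
  case False
  \<comment> \<open>The derivative of \<open>X ^ 2 ^ k - X\<close> is \<open>- 1\<close> in characteristic 2, so this polynomial is separable,
    and its roots form a field.\<close>
  define p :: "bit alg_closure poly" where "p = monom 1 (2 ^ k) - monom 1 1"
  have CHAR: "CHAR(bit alg_closure) = 2" by (simp add: CHAR_bit)
  have two: "of_nat (2 ^ k) = (0 :: bit alg_closure)"
    using False by (simp add: of_nat_eq_0_iff_char_dvd CHAR CHAR_bit del: of_nat_power)
  have gt: "1 < (2 :: nat) ^ k" using False by (intro one_less_power) simp_all
  have deg: "degree p = 2 ^ k"
    unfolding p_def diff_conv_add_uminus using gt
    by (subst degree_add_eq_left) (simp_all add: degree_monom_eq)
  then have nz: "p \<noteq> 0" using gt by auto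
  have root: "poly p x = 0 \<longleftrightarrow> x ^ (2 ^ k) = x" for x
    by (simp add: p_def poly_monom)
  have "poly (pderiv p) x = -1" for x
    unfolding p_def pderiv_diff pderiv_monom two by (simp add: poly_monom)
  then have "card {x. poly p x = 0} = 2 ^ k"
    using card_roots_separable[OF nz] deg by simp
  moreover have "finite {x. poly p x = 0}" using nz by (rule poly_roots_finite)
  \<comment> \<open>Additivity of the iterated Frobenius map closes the roots under
    addition.\<close>
  moreover have "(x + y) ^ (2 ^ k) = x ^ (2 ^ k) + y ^ (2 ^ k)" for x y :: "bit alg_closure"
    by (rule freshmans_dream'[where n = k]) (simp_all add: CHAR CHAR_bit)
  ultimately show ?thesis
    by (intro exI[of _ "{x. poly p x = 0}"]) (auto simp: root power_mult_distrib)
qed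

section \<open>Affine planes\<close>

text \<open>\<open>(s, b)\<close> is the line of slope \<open>s\<close> and intercept
  \<open>b\<close>, and \<open>u\<close> is the abscissa of a point on it.\<close>

definition affine_flags :: "'a :: field set \<Rightarrow> (('a \<times> 'a) \<times> ('a \<times> 'a)) set" where
  "affine_flags F = (\<lambda>(s, b, u). ((s, b), (u, s * u + b))) ` (F \<times> F \<times> F)"

lemma card_affine_flags: "card (affine_flags F) = card F ^ 3"
  unfolding affine_flags_def
  by (subst card_image) (auto simp: inj_on_def card_cartesian_product power3_eq_cube)

lemma partial_linear_space_affine:
  fixes F :: "'a :: field set"
  assumes "finite F" "\<forall>x\<in>F. \<forall>y\<in>F. x + y \<in> F \<and> x * y \<in> F"
  shows "partial_linear_space (F \<times> F) (F \<times> F) (affine_flags F)"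
proof
  show "finite (F \<times> F)" using assms(1) by simp
  show "affine_flags F \<subseteq> (F \<times> F) \<times> (F \<times> F)"
    using assms by (auto simp: affine_flags_def)
  fix l p l' p'
  assume *: "(l, p) \<in> affine_flags F" "(l, p') \<in> affine_flags F"
    "(l', p) \<in> affine_flags F" "(l', p') \<in> affine_flags F"
  obtain s b s' b' u v u' v' where
    eq: "l = (s, b)" "l' = (s', b')" "p = (u, v)" "p' = (u', v')" by (metis surj_pair)
  have h: "v = s * u + b" "v' = s * u' + b" "v = s' * u + b'" "v' = s' * u' + b'"
    using * by (auto simp: affine_flags_def eq)
  \<comment> \<open>The intercepts cancel from the four incidence equations. Equal slopes then force
    \<open>l = l'\<close>, equal abscissas \<open>p = p'\<close>.\<close>
  have "(s - s') * (u - u') = (s * u + b - (s' * u + b')) - (s * u' + b - (s' * u' + b'))"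
    by (simp add: algebra_simps)
  also have "\<dots> = 0"
    unfolding h(1,2)[symmetric] h(3,4)[symmetric] by simp
  finally have "(s - s') * (u - u') = 0" .
  then show "l = l' \<or> p = p'"
    using h by (auto simp: eq)
qed

section \<open>Bounds at powers of two\<close>

lemma inj_edge1: "inj edge1"
  by (auto simp: inj_on_def)

lemma inj_edge2: "inj edge2"
  by (auto simp: inj_on_def)

lemma inj_edge3: "inj edge3"
  by (auto simp: inj_on_def)

lemma NRD_ge:
  assumes "nonredundant_instance D r P Q V E" "finite V" "card V \<le> n" "0 \<in> D"
  shows "card E \<le> NRD D r P Q n"
  using card_le_NRD[OF assms(2,1)] NRD_mono[OF assms(4,3)] by (rule order.trans)

lemma NRD_ge_power2:
  fixes k :: nat
  defines "q \<equiv> 2 ^ k"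
  shows "q ^ 4 \<le> NRD D3 3 P1 Q1 (3 * q ^ 3)"
    and "q ^ 4 \<le> NRD D3 3 P2 Q2 (3 * q ^ 3)"
    and "q ^ 6 \<le> NRD D3 4 P3 Q3 (4 * q ^ 5)"
proof -
  obtain F :: "bit alg_closure set" where F: "finite F" "card F = q"
    "\<forall>x\<in>F. \<forall>y\<in>F. x + y \<in> F \<and> x * y \<in> F"
    using ex_finite_subsemiring_card_power2 unfolding q_def by blast
  interpret partial_linear_space "F \<times> F" "F \<times> F" "affine_flags F"
    by (rule partial_linear_space_affine[OF F(1,3)])
  \<comment> \<open>Taking the levels from \<open>F\<close> as well balances the three kinds of
    vertices at \<open>q ^ 3\<close> each.\<close>
  have V3: "card (V3 F) \<le> 3 * q ^ 3"
    using card_V3[OF F(1)]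
    by (simp add: card_affine_flags card_cartesian_product F(2) power3_eq_cube)
  have V4: "card V4 \<le> 4 * q ^ 5"
    using card_V4
    by (simp add: card_affine_flags card_cartesian_product F(2) eval_nat_numeral algebra_simps)
  have "card (edge1 ` (affine_flags F \<times> F)) = q ^ 4"
    "card (edge2 ` (affine_flags F \<times> F)) = q ^ 4"
    "card (edge3 ` (affine_flags F \<times> affine_flags F)) = q ^ 6"
    by (subst card_image;
        simp add: inj_on_subset[OF inj_edge1] inj_on_subset[OF inj_edge2] inj_on_subset[OF inj_edge3]
          card_affine_flags card_cartesian_product F(2) eval_nat_numeral)+
  then show "q ^ 4 \<le> NRD D3 3 P1 Q1 (3 * q ^ 3)" "q ^ 4 \<le> NRD D3 3 P2 Q2 (3 * q ^ 3)"
    "q ^ 6 \<le> NRD D3 4 P3 Q3 (4 * q ^ 5)"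
    using NRD_ge[OF nonredundant_edges1 finite_V3[OF F(1)] V3] NRD_ge[OF nonredundant_edges2 finite_V3[OF F(1)] V3]
      NRD_ge[OF nonredundant_edges3 finite_V4 V4] by simp_all
qed

section \<open>From powers of two to all \<open>n\<close>\<close>

text \<open>For the largest \<open>k\<close> with \<open>a * (2 ^ k) ^ r \<le> n\<close>, the next
  size exceeds \<open>n\<close> and is only \<open>2 ^ r\<close> times larger, so passing to
  \<open>k\<close> costs a constant factor.\<close>

lemma bigomega_powr_interpolate:
  fixes f :: "nat \<Rightarrow> nat"
  assumes mono: "\<And>m n. m \<le> n \<Longrightarrow> f m \<le> f n"
    and f: "\<And>k. (2 ^ k) ^ s \<le> f (a * (2 ^ k) ^ r)"
    and "0 < a" "0 < r"
  shows "(\<lambda>n. real (f n)) \<in> \<Omega>(\<lambda>n. real n powr (real s / real r))"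
proof (rule landau_omega.bigI)
  define c where "c = (1 / (a * 2 ^ r)) powr (real s / real r)"
  show "0 < c" using assms(3) by (simp add: c_def)
  have "c * real n powr (real s / real r) \<le> real (f n)" if "a \<le> n" for n
  proof -
    \<comment> \<open>Index \<open>n\<close> already overshoots, and index 0 does not because
      \<open>a \<le> n\<close>; so a last good index \<open>k\<close> exists.\<close>
    have "a * (2 ^ n) ^ r > n"
    proof -
      have "n < 2 ^ n" by simp
      also have "\<dots> = (2 ^ n) ^ 1" by simp
      also have "\<dots> \<le> (2 ^ n) ^ r" using assms(4) by (intro power_increasing) auto
      also have "\<dots> \<le> a * (2 ^ n) ^ r" using assms(3) by simp
      finally show ?thesis .
    qed
    moreover have "\<not> n < a * (2 ^ 0) ^ r" using that by simp
    ultimately obtain k where k: "\<forall>i\<le>k. \<not> n < a * (2 ^ i) ^ r" "n < a * (2 ^ Suc k) ^ r"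
      using ex_least_nat_less[of "\<lambda>k. n < a * (2 ^ k) ^ r" n] by (metis Suc_eq_plus1)
    then have le: "a * (2 ^ k) ^ r \<le> n" by (simp add: not_less)
    have "real n \<le> real (a * (2 ^ Suc k) ^ r)" using k(2) by linarith
    also have "\<dots> = real a * 2 ^ r * (2 ^ k) ^ r" by (simp add: power_mult_distrib)
    finally have "1 / (a * 2 ^ r) * real n \<le> (2 ^ k) ^ r"
      using assms(3) by (simp add: field_simps)
    then have "(1 / (a * 2 ^ r) * real n) powr (real s / real r) \<le> ((2 ^ k) ^ r) powr (real s / real r)"
      by (intro powr_mono2) auto
    also have "\<dots> = (2 ^ k) ^ s"
      using assms(4) by (simp add: powr_powr flip: powr_realpow)
    also have "\<dots> = real ((2 ^ k) ^ s)" by simp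
    also have "\<dots> \<le> real (f n)"
      using f[of k] mono[OF le] by linarith
    finally show ?thesis unfolding c_def by (simp only: powr_mult)
  qed
  then show "\<forall>\<^sub>F n in at_top. norm (real (f n)) \<ge> c * norm (real n powr (real s / real r))"
    by (auto intro!: eventually_at_top_linorderI[of a])
qed

theorem theoremC3:
  shows "(\<lambda>n. real (NRD D3 3 P1 Q1 n)) \<in> \<Omega>(\<lambda>n. real n powr (4 / 3)) \<and>
         (\<lambda>n. real (NRD D3 3 P2 Q2 n)) \<in> \<Omega>(\<lambda>n. real n powr (4 / 3)) \<and>
         (\<lambda>n. real (NRD D3 4 P3 Q3 n)) \<in> \<Omega>(\<lambda>n. real n powr (6 / 5))"
proof -
  have mono: "NRD D3 r P Q m \<le> NRD D3 r P Q n" if "m \<le> n" for r P Q m n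
    using that by (rule NRD_mono[rotated]) simp
  show ?thesis
    using bigomega_powr_interpolate[OF mono NRD_ge_power2(1)]
      bigomega_powr_interpolate[OF mono NRD_ge_power2(2)]
      bigomega_powr_interpolate[OF mono NRD_ge_power2(3)]
    by simp
qed

end
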